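(* A real polynomial $P(x)=\sum_{i=0}^d a_ix^i$ of degree $d$ is sign-independently real-rooted if and only if every integer $k=0,\dots,d$ is a central index of $P$.
   Context: A real polynomial is real-rooted if all its complex roots are real. A real-rooted polynomial $P$ is sign-independently real-rooted if each polynomial obtained by an arbitrary sign change of the coefficients of $P$ (i.e. $\sum_i \epsilon_i a_i x^i$ with $\epsilon_i\in\{1,-1\}$) is real-rooted as well. A non-negative integer $k$ is a central index of $P(x)=\sum_{i=0}^d a_ix^i$ if there exists a real number $x_k\ge 0$ such that $|a_k|x_k^k\ge\sum_{i\ne k}|a_i|x_k^i$.
   Formalization: The "if" direction is proved only for polynomials with a_0 ≠ 0, since it is false otherwise: for x^3+x every k is a central index (take x_k=0), yet ±i are roots. The "only if" direction is proved without this condition. *)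

theory Defs
  imports Complex_Main "HOL-Computational_Algebra.Polynomial"
begin

text \<open>The zero polynomial is not real-rooted in this sense, since every complex number is a root of it.\<close>

definition real_rooted :: "real poly \<Rightarrow> bool" where
  "real_rooted P \<longleftrightarrow> (\<forall>z::complex. poly (map_poly complex_of_real P) z = 0 \<longrightarrow> z \<in> \<real>)"

definition sign_change :: "(nat \<Rightarrow> real) \<Rightarrow> real poly \<Rightarrow> real poly" where
  "sign_change \<epsilon> P = (\<Sum>i\<le>degree P. monom (\<epsilon> i * coeff P i) i)"

definition sign_independently_real_rooted :: "real poly \<Rightarrow> bool" where
  "sign_independently_real_rooted P \<longleftrightarrow>
     real_rooted P \<and>
     (\<forall>\<epsilon>::nat \<Rightarrow> real. (\<forall>i. \<epsilon> i \<in> {1, -1}) \<longrightarrow> real_rooted (sign_change \<epsilon> P))"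

text \<open>
  Here \<open>x ^ 0 = 1\<close> also at \<open>x = 0\<close>, so \<open>0\<close> is always a central index (take \<open>x = 0\<close>).
  If the constant coefficient is zero, then at \<open>x = 0\<close> both sides vanish for every \<open>k\<close>,
  so that every \<open>k\<close> is a central index.
\<close>

definition central_index :: "real poly \<Rightarrow> nat \<Rightarrow> bool" where
  "central_index P k \<longleftrightarrow>
     (\<exists>x\<ge>0. \<bar>coeff P k\<bar> * x ^ k \<ge> (\<Sum>i\<in>{0..degree P} - {k}. \<bar>coeff P i\<bar> * x ^ i))"

end

theory Submission
  imports Defs "HOL-Computational_Algebra.Fundamental_Theorem_Algebra"
begin

text \<open>
  Write \<open>a\<^sub>i\<close> for the coefficients of \<open>P\<close> and \<open>d\<close> for its degree.

  If \<open>a\<^sub>0 = 0\<close>, every index is central, as the point \<open>0\<close> shows. Let now \<open>a\<^sub>0 \<noteq> 0\<close>.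

  Suppose \<open>P\<close> is sign-independently real-rooted. If \<open>k\<close> is not a central index, then
  the polynomial obtained by giving \<open>a\<^sub>k\<close> the sign \<open>+\<close> and all other coefficients the sign \<open>-\<close> is
  negative on \<open>[0, \<infinity>)\<close>. Being real-rooted, it is a constant multiple of a product of factors
  \<open>x + r\<close> with \<open>r > 0\<close>, so all its coefficients have the same strict sign
  (lemma \<open>real_rooted_no_nonneg_root_coeff\<close>), which contradicts the chosen sign of \<open>a\<^sub>k\<close>.

  Conversely, suppose every index is central. Being central does not depend on signs,
  so it suffices to show that \<open>P\<close> itself is real-rooted. If the inequalities are strict, at points
  \<open>y\<^sub>k\<close>, then \<open>y\<^sub>0 < \<dots> < y\<^sub>d\<close>, and \<open>P\<close> has at \<open>\<plusminus> y\<^sub>k\<close> the sign of \<open>a\<^sub>k (\<plusminus> y\<^sub>k)\<^sup>k\<close>. Hence \<open>P\<close> changes sign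
  either on \<open>[y\<^sub>k, y\<^sub>k\<^sub>+\<^sub>1]\<close> or on \<open>[-y\<^sub>k\<^sub>+\<^sub>1, -y\<^sub>k]\<close>, which gives \<open>d\<close> distinct real roots
  (lemma \<open>real_rooted_if_strictly_central\<close>). In general, replacing \<open>a\<^sub>i\<close> by \<open>a\<^sub>i t ^ i\<^sup>2\<close> with
  \<open>0 < t < 1\<close> makes all the inequalities strict, and one lets \<open>t\<close> tend to \<open>1\<close>. Real-rootedness
  survives the limit because a real-rooted polynomial satisfies the closed condition
  \<open>\<bar>P z\<bar> \<ge> \<bar>a\<^sub>d\<bar> \<bar>Im z\<bar> ^ d\<close> (lemma \<open>real_rooted_norm_ge\<close>), which in turn forces all roots to be real.
\<close>

section \<open>Real-rooted polynomials\<close>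

lemma degree_map_poly_of_real:
  "degree (map_poly complex_of_real P) = degree P"
  by (rule degree_map_poly) simp

lemma coeff_map_poly_of_real:
  "coeff (map_poly complex_of_real P) i = complex_of_real (coeff P i)"
  by (simp add: coeff_map_poly)

lemma poly_map_poly_of_real:
  "poly (map_poly complex_of_real P) z = (\<Sum>i\<le>degree P. complex_of_real (coeff P i) * z ^ i)"
  by (simp add: poly_altdef degree_map_poly_of_real coeff_map_poly_of_real)

lemma poly_map_poly_of_real_of_real:
  "poly (map_poly complex_of_real P) (complex_of_real x) = complex_of_real (poly P x)"
  unfolding poly_map_poly_of_real poly_altdef[of P] by simp

lemma real_rooted_factorization:
  assumes "real_rooted P"
  obtains r :: "nat \<Rightarrow> real" where
    "map_poly complex_of_real P =
       smult (complex_of_real (lead_coeff P)) (\<Prod>i<degree P. [:- complex_of_real (r i), 1:])"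
    "\<And>i. i < degree P \<Longrightarrow> poly P (r i) = 0"
proof -
  let ?Q = "map_poly complex_of_real P"
  obtain root where root: "smult (lead_coeff ?Q) (\<Prod>i<degree ?Q. [:- root i, 1:]) = ?Q"
    by (rule complex_poly_decompose')
  have Q: "?Q = smult (complex_of_real (lead_coeff P)) (\<Prod>i<degree P. [:- root i, 1:])"
    using root by (simp add: degree_map_poly_of_real coeff_map_poly_of_real)
  have zero: "poly ?Q (root i) = 0" if "i < degree P" for i
    using that by (subst Q) (auto simp: poly_prod intro!: prod_zero)
  have real: "complex_of_real (Re (root i)) = root i" if "i < degree P" for i
    using assms zero[OF that] by (auto simp: real_rooted_def)
  have "(\<Prod>i<degree P. [:- root i, 1:]) = (\<Prod>i<degree P. [:- complex_of_real (Re (root i)), 1:])"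
    by (rule prod.cong) (auto simp: real)
  moreover have "poly P (Re (root i)) = 0" if "i < degree P" for i
    using zero[OF that] poly_map_poly_of_real_of_real[of P "Re (root i)"] real[OF that] by simp
  ultimately show thesis
    using Q that[of "\<lambda>i. Re (root i)"] by simp
qed

text \<open>Every factor \<open>z - r\<close> with \<open>r\<close> real has modulus at least \<open>\<bar>Im z\<bar>\<close>.\<close>

lemma real_rooted_norm_ge:
  assumes "real_rooted P"
  shows "\<bar>lead_coeff P\<bar> * \<bar>Im z\<bar> ^ degree P \<le> norm (poly (map_poly complex_of_real P) z)"
proof -
  obtain r where r: "map_poly complex_of_real P =
       smult (complex_of_real (lead_coeff P)) (\<Prod>i<degree P. [:- complex_of_real (r i), 1:])"
    using real_rooted_factorization[OF assms] by metis
  have "\<bar>Im z\<bar> ^ degree P = (\<Prod>i<degree P. \<bar>Im z\<bar>)" by simp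
  also have "\<dots> \<le> (\<Prod>i<degree P. norm (z - complex_of_real (r i)))"
  proof (rule prod_mono)
    fix i
    show "0 \<le> \<bar>Im z\<bar> \<and> \<bar>Im z\<bar> \<le> norm (z - complex_of_real (r i))"
      using abs_Im_le_cmod[of "z - complex_of_real (r i)"] by simp
  qed
  finally have "\<bar>lead_coeff P\<bar> * \<bar>Im z\<bar> ^ degree P
      \<le> \<bar>lead_coeff P\<bar> * (\<Prod>i<degree P. norm (z - complex_of_real (r i)))"
    by (rule mult_left_mono) simp
  also have "\<dots> = norm (poly (map_poly complex_of_real P) z)"
    by (subst r) (simp add: poly_prod norm_mult prod_norm)
  finally show ?thesis .
qed

lemma coeff_prod_pos:
  fixes s :: "nat \<Rightarrow> real"
  assumes "\<And>i. i < n \<Longrightarrow> s i > 0" "k \<le> n"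
  shows "\<exists>c>0. coeff (\<Prod>i<n. [:complex_of_real (s i), 1:]) k = complex_of_real c"
  using assms
proof (induction n arbitrary: k)
  case 0
  then show ?case by (auto intro: exI[of _ 1])
next
  case (Suc n)
  let ?p = "\<Prod>i<n. [:complex_of_real (s i), 1:]"
  have IH: "\<exists>c>0. coeff ?p j = complex_of_real c" if "j \<le> n" for j
    using Suc that by simp
  have above: "coeff ?p (Suc n) = 0"
    by (rule coeff_eq_0) (simp add: degree_prod_sum_eq)
  have prod: "(\<Prod>i<Suc n. [:complex_of_real (s i), 1:]) = [:complex_of_real (s n), 1:] * ?p"
    by (simp add: mult.commute)
  have sn: "s n > 0" using Suc.prems by simp
  show ?case
  proof (cases k)
    case 0
    obtain c where "c > 0" "coeff ?p 0 = complex_of_real c" using IH by blast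
    then show ?thesis
      unfolding prod 0 using sn by (intro exI[of _ "s n * c"]) simp
  next
    case (Suc j)
    then have "j \<le> n" using \<open>k \<le> Suc n\<close> by simp
    then obtain c where c: "c > 0" "coeff ?p j = complex_of_real c" using IH by blast
    obtain c' where c': "c' \<ge> 0" "coeff ?p (Suc j) = complex_of_real c'"
    proof (cases "j = n")
      case True
      then show ?thesis using above that[of 0] by simp
    next
      case False
      then have "Suc j \<le> n" using \<open>j \<le> n\<close> by simp
      then show ?thesis using IH[of "Suc j"] that by (metis less_imp_le)
    qed
    have "s n * c' + c > 0" using sn c c' by (simp add: add_nonneg_pos)
    then show ?thesis
      unfolding prod Suc using c c' by (intro exI[of _ "s n * c' + c"]) simp
  qed
qed

lemma real_rooted_no_nonneg_root_coeff:
  assumes "real_rooted P" "\<And>x. x \<ge> 0 \<Longrightarrow> poly P x \<noteq> 0" "k \<le> degree P"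
  shows "\<exists>c>0. coeff P k = lead_coeff P * c"
proof -
  obtain r where r: "map_poly complex_of_real P =
       smult (complex_of_real (lead_coeff P)) (\<Prod>i<degree P. [:- complex_of_real (r i), 1:])"
    "\<And>i. i < degree P \<Longrightarrow> poly P (r i) = 0"
    using real_rooted_factorization[OF assms(1)] by metis
  have "- r i > 0" if "i < degree P" for i
    using assms(2)[of "r i"] r(2)[OF that] by linarith
  then obtain c where c: "c > 0"
    "coeff (\<Prod>i<degree P. [:complex_of_real (- r i), 1:]) k = complex_of_real c"
    using coeff_prod_pos[of "degree P" "\<lambda>i. - r i" k] assms(3) by auto
  have "complex_of_real (coeff P k) = coeff (map_poly complex_of_real P) k"
    by (simp add: coeff_map_poly_of_real)
  also have "\<dots> = complex_of_real (lead_coeff P * c)"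
    using c by (subst r(1)) simp
  finally show ?thesis using c by (auto simp del: of_real_mult)
qed

section \<open>Dominating terms and real roots\<close>

lemma sgn_dominated_sum:
  fixes f :: "nat \<Rightarrow> real"
  assumes "finite A" "k \<in> A" "(\<Sum>i\<in>A - {k}. \<bar>f i\<bar>) < \<bar>f k\<bar>"
  shows "sgn (\<Sum>i\<in>A. f i) = sgn (f k)"
proof -
  have sum: "(\<Sum>i\<in>A. f i) = f k + (\<Sum>i\<in>A - {k}. f i)"
    using assms by (simp add: sum.remove)
  have less: "\<bar>\<Sum>i\<in>A - {k}. f i\<bar> < \<bar>f k\<bar>"
    using sum_abs[of f "A - {k}"] assms(3) by linarith
  show ?thesis
  proof (cases "f k > 0")
    case True
    then have "(\<Sum>i\<in>A. f i) > 0" using sum less by linarith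
    then show ?thesis using True by (simp only: sgn_pos)
  next
    case False
    then have "f k < 0" "(\<Sum>i\<in>A. f i) < 0" using sum less by linarith+
    then show ?thesis by (simp only: sgn_neg)
  qed
qed

text \<open>
  The term of index \<open>k\<close> strictly exceeds, at \<open>y \<ge> 0\<close>, the sum of all the other terms in absolute
  value. The point \<open>y = 0\<close> is possible only for \<open>k = 0\<close>, where \<open>0 ^ 0 = 1\<close>.
\<close>

definition strictly_central_at :: "real poly \<Rightarrow> nat \<Rightarrow> real \<Rightarrow> bool" where
  "strictly_central_at P k y \<longleftrightarrow>
     y \<ge> 0 \<and> (\<Sum>i\<in>{0..degree P} - {k}. \<bar>coeff P i\<bar> * y ^ i) < \<bar>coeff P k\<bar> * y ^ k"

lemma strictly_central_at_term_less:
  assumes "strictly_central_at P k y" "i \<le> degree P" "i \<noteq> k"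
  shows "\<bar>coeff P i\<bar> * y ^ i < \<bar>coeff P k\<bar> * y ^ k"
proof -
  have "\<bar>coeff P i\<bar> * y ^ i \<le> (\<Sum>i\<in>{0..degree P} - {k}. \<bar>coeff P i\<bar> * y ^ i)"
    using assms by (intro member_le_sum) (auto simp: strictly_central_at_def)
  then show ?thesis using assms(1) by (simp add: strictly_central_at_def)
qed

lemma strictly_central_at_pos:
  assumes "strictly_central_at P k y"
  shows "\<bar>coeff P k\<bar> > 0" "y ^ k > 0"
proof -
  have "y \<ge> 0" using assms by (simp add: strictly_central_at_def)
  have "0 \<le> (\<Sum>i\<in>{0..degree P} - {k}. \<bar>coeff P i\<bar> * y ^ i)"
    using \<open>y \<ge> 0\<close> by (intro sum_nonneg) simp
  then have "\<bar>coeff P k\<bar> * y ^ k > 0"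
    using assms by (simp add: strictly_central_at_def)
  moreover have "y ^ k \<ge> 0" using \<open>y \<ge> 0\<close> by simp
  ultimately show "\<bar>coeff P k\<bar> > 0" "y ^ k > 0"
    by (simp_all add: zero_less_mult_iff)
qed

lemma strictly_central_at_sgn:
  assumes "strictly_central_at P k y" "k \<le> degree P"
  shows "sgn (poly P y) = sgn (coeff P k)"
    and "sgn (poly P (- y)) = (-1) ^ k * sgn (coeff P k)"
proof -
  have "y \<ge> 0" using assms by (simp add: strictly_central_at_def)
  have dom: "sgn (poly P x) = sgn (coeff P k * x ^ k)" if "\<bar>x\<bar> = y" for x
    unfolding poly_altdef
  proof (rule sgn_dominated_sum)
    have "{..degree P} = {0..degree P}" by auto
    then show "(\<Sum>i\<in>{..degree P} - {k}. \<bar>coeff P i * x ^ i\<bar>) < \<bar>coeff P k * x ^ k\<bar>"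
      using assms(1) that by (simp add: strictly_central_at_def abs_mult power_abs)
  qed (use assms in auto)
  have yk: "sgn (y ^ k) = 1" using strictly_central_at_pos(2)[OF assms(1)] by (rule sgn_pos)
  show "sgn (poly P y) = sgn (coeff P k)"
    using dom[of y] \<open>y \<ge> 0\<close> by (simp only: sgn_mult yk mult_1_right abs_of_nonneg)
  have "sgn ((- y) ^ k) = (-1) ^ k"
    using yk by (subst power_minus, cases "even k") (simp_all add: sgn_mult)
  then show "sgn (poly P (- y)) = (-1) ^ k * sgn (coeff P k)"
    using dom[of "- y"] \<open>y \<ge> 0\<close>
    by (simp only: sgn_mult abs_minus_cancel abs_of_nonneg mult.commute)
qed

lemma strictly_central_at_mono:
  assumes "strictly_central_at P k y" "strictly_central_at P (Suc k) y'" "Suc k \<le> degree P"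
  shows "y < y'"
proof (rule ccontr)
  assume "\<not> y < y'"
  have y: "y ^ k > 0" using strictly_central_at_pos[OF assms(1)] by simp
  have y'0: "y' \<ge> 0" using assms by (simp add: strictly_central_at_def)
  have y': "y' ^ k > 0"
    using strictly_central_at_pos(2)[OF assms(2)] y'0 by (simp add: zero_less_mult_iff)
  have "(\<bar>coeff P (Suc k)\<bar> * y) * y ^ k < \<bar>coeff P k\<bar> * y ^ k"
    using strictly_central_at_term_less[OF assms(1), of "Suc k"] assms(3) by (simp add: mult_ac)
  then have 1: "\<bar>coeff P (Suc k)\<bar> * y < \<bar>coeff P k\<bar>" using y by simp
  have "\<bar>coeff P k\<bar> * y' ^ k < (\<bar>coeff P (Suc k)\<bar> * y') * y' ^ k"
    using strictly_central_at_term_less[OF assms(2), of k] assms(3) by (simp add: mult_ac)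
  then have 2: "\<bar>coeff P k\<bar> < \<bar>coeff P (Suc k)\<bar> * y'" using y' by simp
  have "\<bar>coeff P (Suc k)\<bar> * y' \<le> \<bar>coeff P (Suc k)\<bar> * y"
    using \<open>\<not> y < y'\<close> by (intro mult_left_mono) auto
  then show False using 1 2 by linarith
qed

text \<open>
  Of the pairs \<open>(y, y')\<close> and \<open>(-y', -y)\<close>, exactly one shows a change of sign, because
  passing from \<open>k\<close> to \<open>k + 1\<close> flips the factor \<open>(-1) ^ k\<close> in the sign at the negative point.
\<close>

lemma strictly_central_at_root_between:
  assumes "strictly_central_at P k y" "strictly_central_at P (Suc k) y'" "Suc k \<le> degree P"
  shows "\<exists>x. y < \<bar>x\<bar> \<and> \<bar>x\<bar> < y' \<and> poly P x = 0"
proof -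
  have "y < y'" by (rule strictly_central_at_mono[OF assms])
  have "y \<ge> 0" using assms by (simp add: strictly_central_at_def)
  have k: "k \<le> degree P" using assms(3) by simp
  note s = strictly_central_at_sgn[OF assms(1) k] strictly_central_at_sgn[OF assms(2,3)]
  let ?a = "sgn (coeff P k) * sgn (coeff P (Suc k))"
  have "sgn (poly P y * poly P y') = ?a" by (simp add: sgn_mult s)
  moreover have "sgn (poly P (- y') * poly P (- y)) = - ?a"
    by (cases "even k") (simp_all add: sgn_mult s)
  moreover have "?a \<noteq> 0"
    using strictly_central_at_pos(1)[OF assms(1)] strictly_central_at_pos(1)[OF assms(2)]
    by (simp add: sgn_zero_iff)
  ultimately have "poly P y * poly P y' < 0 \<or> poly P (- y') * poly P (- y) < 0"
    by (metis linorder_neqE_linordered_idom neg_less_0_iff_less sgn_less)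
  then show ?thesis
  proof
    assume "poly P y * poly P y' < 0"
    from poly_IVT[OF \<open>y < y'\<close> this] \<open>y \<ge> 0\<close> show ?thesis by force
  next
    assume "poly P (- y') * poly P (- y) < 0"
    moreover have "- y' < - y" using \<open>y < y'\<close> by simp
    ultimately obtain x where "x > - y'" "x < - y" "poly P x = 0"
      using poly_IVT by blast
    with \<open>y \<ge> 0\<close> show ?thesis by (intro exI[of _ x]) auto
  qed
qed

lemma real_rooted_if_strictly_central:
  assumes "P \<noteq> 0" and central: "\<And>k. k \<le> degree P \<Longrightarrow> \<exists>y. strictly_central_at P k y"
  shows "real_rooted P"
proof -
  obtain y where y: "\<And>k. k \<le> degree P \<Longrightarrow> strictly_central_at P k (y k)"
    using central by metis
  have "\<exists>x. y k < \<bar>x\<bar> \<and> \<bar>x\<bar> < y (Suc k) \<and> poly P x = 0" if "k < degree P" for k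
    using that by (intro strictly_central_at_root_between[of P k] y) auto
  then obtain r where r: "\<And>k. k < degree P \<Longrightarrow> y k < \<bar>r k\<bar> \<and> \<bar>r k\<bar> < y (Suc k) \<and> poly P (r k) = 0"
    by metis
  have mono: "y i \<le> y j" if "i \<le> j" "j \<le> degree P" for i j
    using that
  proof (induction j rule: dec_induct)
    case (step j)
    then have "y j < y (Suc j)" by (intro strictly_central_at_mono[of P j] y) auto
    then show ?case using step by simp
  qed simp
  have less: "\<bar>r i\<bar> < \<bar>r j\<bar>" if "i < j" "j < degree P" for i j
    using r[of i] r[of j] mono[of "Suc i" j] that by auto
  have "inj_on r {..<degree P}"
    by (rule linorder_inj_onI) (use less in fastforce)+
  then have inj: "inj_on (\<lambda>k. complex_of_real (r k)) {..<degree P}"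
    by (auto simp: inj_on_def)
  \<comment> \<open>The \<open>r k\<close> are as many distinct roots as the degree allows, hence they are all the roots.\<close>
  let ?Q = "map_poly complex_of_real P"
  let ?S = "(\<lambda>k. complex_of_real (r k)) ` {..<degree P}"
  have "lead_coeff ?Q \<noteq> 0"
    using \<open>P \<noteq> 0\<close> by (simp add: coeff_map_poly_of_real degree_map_poly_of_real)
  then have Q: "?Q \<noteq> 0" by auto
  have "?S = {z. poly ?Q z = 0}"
  proof (rule card_seteq)
    show "finite {z. poly ?Q z = 0}" using Q by (rule poly_roots_finite)
    show "?S \<subseteq> {z. poly ?Q z = 0}" using r by (auto simp: poly_map_poly_of_real_of_real)
    show "card {z. poly ?Q z = 0} \<le> card ?S"
      using card_poly_roots_bound[OF Q] by (simp add: card_image[OF inj] degree_map_poly_of_real)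
  qed
  moreover have "?S \<subseteq> \<real>" by auto
  ultimately show ?thesis unfolding real_rooted_def by blast
qed

section \<open>Passing to the limit\<close>

text \<open>The polynomial with coefficients \<open>a\<^sub>i t ^ i\<^sup>2\<close>, where \<open>a\<^sub>i\<close> are those of \<open>P\<close>.\<close>

definition square_scale :: "real \<Rightarrow> real poly \<Rightarrow> real poly" where
  "square_scale t P = (\<Sum>i\<le>degree P. monom (coeff P i * t ^ (i\<^sup>2)) i)"

lemma coeff_square_scale: "coeff (square_scale t P) i = coeff P i * t ^ (i\<^sup>2)"
  by (simp add: square_scale_def coeff_sum coeff_eq_0)

lemma degree_square_scale:
  assumes "t \<noteq> 0"
  shows "degree (square_scale t P) = degree P"
proof (cases "P = 0")
  case False
  show ?thesis
  proof (rule antisym)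
    show "degree (square_scale t P) \<le> degree P"
      by (rule degree_le) (simp add: coeff_square_scale coeff_eq_0)
    show "degree P \<le> degree (square_scale t P)"
      using False assms by (intro le_degree) (simp add: coeff_square_scale)
  qed
qed (simp add: square_scale_def)

text \<open>
  If the term of index \<open>k\<close> dominates in \<open>P\<close> at \<open>x\<close>, it dominates in \<open>square_scale t P\<close> at
  \<open>x / t ^ (2 * k)\<close>: up to the common factor \<open>t ^ k\<^sup>2\<close>, the term of index \<open>i\<close> gets multiplied
  by \<open>t ^ (i - k)\<^sup>2\<close>.
\<close>

lemma square_scale_strictly_central:
  assumes t: "0 < t" "t < 1" and "coeff P 0 \<noteq> 0" "central_index P k"
  shows "\<exists>y. strictly_central_at (square_scale t P) k y"
proof (cases "k = 0")
  case True
  have "(\<Sum>i\<in>{0..degree P} - {0}. \<bar>coeff P i * t ^ (i\<^sup>2)\<bar> * 0 ^ i) = 0"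
    by (intro sum.neutral) auto
  then have "strictly_central_at (square_scale t P) 0 0"
    using t assms(3) by (simp add: strictly_central_at_def degree_square_scale coeff_square_scale)
  then show ?thesis using True by blast
next
  case False
  obtain x where x: "x \<ge> 0"
    "(\<Sum>i\<in>{0..degree P} - {k}. \<bar>coeff P i\<bar> * x ^ i) \<le> \<bar>coeff P k\<bar> * x ^ k"
    using assms(4) by (auto simp: central_index_def)
  define y where "y = x / t ^ (2 * k)"
  have tk: "t ^ (k\<^sup>2) > 0" using t by simp
  have term_eq: "t ^ (k\<^sup>2) * (\<bar>coeff P i * t ^ (i\<^sup>2)\<bar> * y ^ i) =
      (\<bar>coeff P i\<bar> * x ^ i) * t ^ (k\<^sup>2 + i\<^sup>2 - 2 * k * i)" for i
  proof -
    have "real (2 * k * i) \<le> real (k\<^sup>2 + i\<^sup>2)"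
      using sum_squares_bound[of "real k" "real i"] by simp
    then have "2 * k * i \<le> k\<^sup>2 + i\<^sup>2" by (simp only: of_nat_le_iff)
    then have split: "t ^ (k\<^sup>2) * t ^ (i\<^sup>2) = t ^ (k\<^sup>2 + i\<^sup>2 - 2 * k * i) * t ^ (2 * k * i)"
      by (simp flip: power_add)
    have yi: "t ^ (2 * k * i) * y ^ i = x ^ i"
      using t by (simp add: y_def power_divide power_mult)
    have "t ^ (k\<^sup>2) * (\<bar>coeff P i * t ^ (i\<^sup>2)\<bar> * y ^ i) =
        \<bar>coeff P i\<bar> * (t ^ (k\<^sup>2) * t ^ (i\<^sup>2)) * y ^ i"
      using t by (simp add: abs_mult)
    also have "\<dots> = \<bar>coeff P i\<bar> * t ^ (k\<^sup>2 + i\<^sup>2 - 2 * k * i) * (t ^ (2 * k * i) * y ^ i)"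
      by (simp only: split mult.assoc)
    finally show ?thesis unfolding yi by (simp only: mult_ac)
  qed
  have le: "(\<bar>coeff P i\<bar> * x ^ i) * t ^ (k\<^sup>2 + i\<^sup>2 - 2 * k * i) \<le> \<bar>coeff P i\<bar> * x ^ i" for i
    using t x(1) by (intro mult_left_le power_le_one) auto
  \<comment> \<open>The constant term is nonzero, so its strict decrease makes the inequality strict.\<close>
  have "t ^ (k\<^sup>2) < 1"
    using t False by (simp add: power_less_one_iff)
  then have less: "(\<bar>coeff P 0\<bar> * x ^ 0) * t ^ (k\<^sup>2 + 0\<^sup>2 - 2 * k * 0) < \<bar>coeff P 0\<bar> * x ^ 0"
    using assms(3) by simp
  have "t ^ (k\<^sup>2) * (\<Sum>i\<in>{0..degree P} - {k}. \<bar>coeff P i * t ^ (i\<^sup>2)\<bar> * y ^ i) =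
      (\<Sum>i\<in>{0..degree P} - {k}. (\<bar>coeff P i\<bar> * x ^ i) * t ^ (k\<^sup>2 + i\<^sup>2 - 2 * k * i))"
    by (simp only: sum_distrib_left term_eq)
  also have "\<dots> < (\<Sum>i\<in>{0..degree P} - {k}. \<bar>coeff P i\<bar> * x ^ i)"
    by (rule sum_strict_mono_ex1) (use False less le in \<open>auto intro!: bexI[of _ 0]\<close>)
  also have "\<dots> \<le> \<bar>coeff P k\<bar> * x ^ k" by (rule x(2))
  also have "\<dots> = t ^ (k\<^sup>2) * (\<bar>coeff P k * t ^ (k\<^sup>2)\<bar> * y ^ k)"
    unfolding term_eq by (simp add: power2_eq_square)
  finally have "strictly_central_at (square_scale t P) k y"
    using t tk x(1)
    by (simp add: strictly_central_at_def degree_square_scale coeff_square_scale y_def)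
  then show ?thesis ..
qed

lemma real_rooted_if_central:
  assumes "coeff P 0 \<noteq> 0" and central: "\<And>k. k \<le> degree P \<Longrightarrow> central_index P k"
  shows "real_rooted P"
  unfolding real_rooted_def
proof (intro allI impI)
  fix z :: complex
  assume z: "poly (map_poly complex_of_real P) z = 0"
  have "P \<noteq> 0" using assms by auto
  have bound: "\<bar>lead_coeff P * t ^ ((degree P)\<^sup>2)\<bar> * \<bar>Im z\<bar> ^ degree P \<le>
      norm (\<Sum>i\<le>degree P. complex_of_real (coeff P i * t ^ (i\<^sup>2)) * z ^ i)"
    if t: "0 < t" "t < 1" for t
  proof -
    have deg: "degree (square_scale t P) = degree P" using t by (simp add: degree_square_scale)
    have "coeff (square_scale t P) 0 \<noteq> 0" using assms(1) by (simp add: coeff_square_scale)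
    then have "square_scale t P \<noteq> 0" by auto
    moreover have "\<exists>y. strictly_central_at (square_scale t P) k y"
      if "k \<le> degree (square_scale t P)" for k
      using that square_scale_strictly_central[OF t assms(1)] central deg by simp
    ultimately have "real_rooted (square_scale t P)"
      by (rule real_rooted_if_strictly_central)
    from real_rooted_norm_ge[OF this, of z] show ?thesis
      by (simp add: deg coeff_square_scale poly_map_poly_of_real)
  qed
  define u :: "nat \<Rightarrow> real" where "u n = 1 - 1 / (real n + 2)" for n
  have u: "0 < u n" "u n < 1" for n by (simp_all add: u_def field_simps)
  have "(\<lambda>n. 1 / (real (n + 2))) \<longlonglongrightarrow> 0"
    by (rule LIMSEQ_ignore_initial_segment) (rule lim_1_over_n)
  then have "(\<lambda>n. 1 - 1 / (real n + 2)) \<longlonglongrightarrow> 1 - 0"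
    by (intro tendsto_intros) (simp add: add.commute)
  then have lim: "u \<longlonglongrightarrow> 1" by (simp add: u_def[abs_def])
  have "(\<lambda>n. \<bar>lead_coeff P * u n ^ ((degree P)\<^sup>2)\<bar> * \<bar>Im z\<bar> ^ degree P)
      \<longlonglongrightarrow> \<bar>lead_coeff P * 1 ^ ((degree P)\<^sup>2)\<bar> * \<bar>Im z\<bar> ^ degree P"
    by (intro tendsto_intros lim)
  moreover have "(\<lambda>n. norm (\<Sum>i\<le>degree P. complex_of_real (coeff P i * u n ^ (i\<^sup>2)) * z ^ i))
      \<longlonglongrightarrow> norm (\<Sum>i\<le>degree P. complex_of_real (coeff P i * 1 ^ (i\<^sup>2)) * z ^ i)"
    by (intro tendsto_intros lim)
  ultimately have "\<bar>lead_coeff P * 1 ^ ((degree P)\<^sup>2)\<bar> * \<bar>Im z\<bar> ^ degree P \<le>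
      norm (\<Sum>i\<le>degree P. complex_of_real (coeff P i * 1 ^ (i\<^sup>2)) * z ^ i)"
    by (rule LIMSEQ_le) (use bound u in blast)
  then have "\<bar>lead_coeff P\<bar> * \<bar>Im z\<bar> ^ degree P \<le> 0"
    using z by (simp add: poly_map_poly_of_real)
  moreover have "\<bar>lead_coeff P\<bar> > 0" using \<open>P \<noteq> 0\<close> by simp
  moreover have "\<bar>lead_coeff P\<bar> * \<bar>Im z\<bar> ^ degree P > 0" if "Im z \<noteq> 0"
    using that \<open>P \<noteq> 0\<close> by simp
  ultimately have "Im z = 0" by (metis not_less)
  then show "z \<in> \<real>" by (simp add: complex_is_Real_iff)
qed

section \<open>Sign changes\<close>

lemma coeff_sign_change: "coeff (sign_change \<epsilon> P) i = \<epsilon> i * coeff P i"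
  by (simp add: sign_change_def coeff_sum coeff_eq_0)

lemma degree_sign_change:
  assumes "\<And>i. \<epsilon> i \<in> {1, -1}"
  shows "degree (sign_change \<epsilon> P) = degree P"
proof (cases "P = 0")
  case False
  have "\<epsilon> (degree P) \<noteq> 0" using assms[of "degree P"] by auto
  show ?thesis
  proof (rule antisym)
    show "degree (sign_change \<epsilon> P) \<le> degree P"
      by (rule degree_le) (simp add: coeff_sign_change coeff_eq_0)
    show "degree P \<le> degree (sign_change \<epsilon> P)"
      using False \<open>\<epsilon> (degree P) \<noteq> 0\<close> by (intro le_degree) (simp add: coeff_sign_change)
  qed
qed (simp add: sign_change_def)

lemma central_index_sign_change:
  assumes "\<And>i. \<epsilon> i \<in> {1, -1}"
  shows "central_index (sign_change \<epsilon> P) k \<longleftrightarrow> central_index P k"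
proof -
  have "\<bar>\<epsilon> i * c\<bar> = \<bar>c\<bar>" for i c using assms[of i] by auto
  then show ?thesis
    by (simp add: central_index_def degree_sign_change[OF assms] coeff_sign_change)
qed

lemma sign_independently_real_rooted_if_central:
  assumes "coeff P 0 \<noteq> 0" and "\<And>k. k \<le> degree P \<Longrightarrow> central_index P k"
  shows "sign_independently_real_rooted P"
  unfolding sign_independently_real_rooted_def
proof (intro conjI allI impI)
  show "real_rooted P" using assms by (rule real_rooted_if_central)
  fix \<epsilon> :: "nat \<Rightarrow> real"
  assume "\<forall>i. \<epsilon> i \<in> {1, -1}"
  then have \<epsilon>: "\<And>i. \<epsilon> i \<in> {1, -1}" by blast
  have "coeff (sign_change \<epsilon> P) 0 \<noteq> 0"
    using assms(1) \<epsilon>[of 0] by (auto simp: coeff_sign_change)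
  then show "real_rooted (sign_change \<epsilon> P)"
    using assms(2) by (intro real_rooted_if_central)
      (simp_all add: degree_sign_change[OF \<epsilon>] central_index_sign_change[OF \<epsilon>])
qed

lemma central_index_if_coeff_0_eq_0:
  assumes "coeff P 0 = 0"
  shows "central_index P k"
proof -
  have "\<bar>coeff P i\<bar> * 0 ^ i = 0" for i using assms by (cases i) auto
  then show ?thesis
    unfolding central_index_def
    by (intro exI[of _ 0] conjI) (simp_all only: sum.neutral_const order_refl)
qed

lemma central_index_if_sign_independently_real_rooted:
  assumes "sign_independently_real_rooted P" "k \<le> degree P"
  shows "central_index P k"
proof (rule ccontr)
  assume not_central: "\<not> central_index P k"
  then have "P \<noteq> 0" using central_index_if_coeff_0_eq_0 by force
  \<comment> \<open>The signs make the coefficient of index \<open>k\<close> nonnegative and all others nonpositive.\<close>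
  define \<epsilon> :: "nat \<Rightarrow> real" where
    "\<epsilon> i = (if i = k then (if coeff P i \<ge> 0 then 1 else -1)
            else (if coeff P i \<ge> 0 then -1 else 1))" for i
  define R where "R = sign_change \<epsilon> P"
  have \<epsilon>: "\<And>i. \<epsilon> i \<in> {1, -1}" by (simp add: \<epsilon>_def)
  have deg: "degree R = degree P" unfolding R_def by (rule degree_sign_change[OF \<epsilon>])
  have ck: "coeff R k = \<bar>coeff P k\<bar>" by (simp add: R_def coeff_sign_change \<epsilon>_def)
  have ci: "coeff R i = - \<bar>coeff P i\<bar>" if "i \<noteq> k" for i
    using that by (simp add: R_def coeff_sign_change \<epsilon>_def)
  have neg: "poly R x < 0" if "x \<ge> 0" for x
  proof -
    have "poly R x = (\<Sum>i\<in>{0..degree P}. coeff R i * x ^ i)"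
      by (simp add: poly_altdef deg atLeast0AtMost)
    also have "\<dots> = coeff R k * x ^ k + (\<Sum>i\<in>{0..degree P} - {k}. coeff R i * x ^ i)"
      using assms(2) by (intro sum.remove) auto
    also have "(\<Sum>i\<in>{0..degree P} - {k}. coeff R i * x ^ i) =
        - (\<Sum>i\<in>{0..degree P} - {k}. \<bar>coeff P i\<bar> * x ^ i)"
      by (simp add: ci flip: sum_negf)
    finally show ?thesis
      using not_central that by (simp add: central_index_def ck not_le) (meson not_le)
  qed
  have rr: "real_rooted R"
    using assms(1) \<epsilon> unfolding sign_independently_real_rooted_def R_def by blast
  obtain c where c: "c > 0" "coeff R k = lead_coeff R * c"
    using real_rooted_no_nonneg_root_coeff[OF rr, of k] neg assms(2) deg by force
  obtain c0 where c0: "c0 > 0" "coeff R 0 = lead_coeff R * c0"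
    using real_rooted_no_nonneg_root_coeff[OF rr, of 0] neg by force
  have "coeff R 0 < 0" using neg[of 0] by (simp add: poly_0_coeff_0)
  then have "lead_coeff R < 0" using c0 by (simp add: mult_less_0_iff)
  then have "coeff R k < 0" using c by (simp add: mult_neg_pos)
  then show False by (simp add: ck)
qed

theorem proposition1:
  fixes P :: "real poly" and d :: nat
  assumes "P \<noteq> 0" and "degree P = d"
  shows "(sign_independently_real_rooted P \<longrightarrow> (\<forall>k\<in>{0..d}. central_index P k)) \<and>
         (coeff P 0 \<noteq> 0 \<longrightarrow>
            (sign_independently_real_rooted P \<longleftrightarrow> (\<forall>k\<in>{0..d}. central_index P k)))"
proof -
  have "\<forall>k\<in>{0..d}. central_index P k" if "sign_independently_real_rooted P"
    using central_index_if_sign_independently_real_rooted[OF that] assms(2) by simp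
  moreover have "sign_independently_real_rooted P"
    if "coeff P 0 \<noteq> 0" "\<forall>k\<in>{0..d}. central_index P k"
    using that assms(2) by (intro sign_independently_real_rooted_if_central) auto
  ultimately show ?thesis by blast
qed

end
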